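(* Let $n \ge 1$ and let $v$ be an order ideal of the shifted staircase $\mathrm{SS}_n$, with binary representation $s = s_1 s_2 \cdots s_n$. Then $v$ is an Eeta win in the lattice $J(\mathrm{SS}_n)$ if and only if both of the following hold: (i) $s_n = 0$; and (ii) in the string $s_{1:n-1} = s_1\cdots s_{n-1}$ there is no maximal block of consecutive $1$s of odd length that is immediately followed by a maximal block of consecutive $0$s of odd length.
   Context: Ungar game. Let $L$ be a finite meet-semilattice with minimum $\hat 0$. An Ungar move from $v \in L$ sends $v$ to the meet $\bigwedge(\{v\}\cup T)$, where $T$ is a subset of the set of elements covered by $v$; the move is nontrivial if $T \neq \emptyset$. The Ungar game starting at $v$ is played on the interval $[\hat 0, v]$: two players, Atniss (who moves first) and Eeta, alternately make nontrivial Ungar moves; the player who cannot make a nontrivial Ungar move loses. The element $v$ is an Atniss win if Atniss has a winning strategy, and an Eeta win otherwise. Shifted staircase. $\mathrm{SS}_n$ is the poset of lattice points $(i,j)$ with $1 \le i \le j \le n$, ordered by $(i,j)\le(i',j')$ iff $i\le i'$ and $j \le j'$. $J(\mathrm{SS}_n)$ is the lattice of order ideals of $\mathrm{SS}_n$ ordered by inclusion (meet = intersection). An order ideal $v$ is determined by the numbers $\lambda_i$ of its points in row $i$ (points $(i,j)$), whose nonzero values form a strictly decreasing sequence of integers in $\{1,\dots,n\}$. The binary representation of $v$ is the length-$n$ string $s=s_1\cdots s_n$ with $s_k = 1$ iff $n-k+1$ is one of the nonzero $\lambda_i$ (equivalently, reading the lattice path lying directly above $v$, up steps give $1$ and down steps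 give $0$). The rank of $v$ is $\sum_{k=1}^n (n-k+1)s_k$. Equivalently, $u \lessdot v$ in $J(\mathrm{SS}_n)$ iff the binary representation of $u$ is obtained from that $t$ of $v$ either by replacing a consecutive pair $t_it_{i+1}=10$ by $01$, or, when $t_n=1$, by replacing $t_n$ by $0$. A maximal block of $1$s (resp. $0$s) in a string is a maximal substring of consecutive $1$s (resp. $0$s). *)

theory Defs
  imports "HOL-Algebra.Lattice"
begin

section \<open>The Ungar game\<close>

text \<open>
  The definitions below make sense for any record \<open>L\<close>; they are meant for a finite
  meet-semilattice.
\<close>

definition lower_covers :: "('a, 'b) gorder_scheme \<Rightarrow> 'a \<Rightarrow> 'a set" where
  "lower_covers L v = {u \<in> carrier L. u \<sqsubset>\<^bsub>L\<^esub> v \<and> \<not> (\<exists>w\<in>carrier L. u \<sqsubset>\<^bsub>L\<^esub> w \<and> w \<sqsubset>\<^bsub>L\<^esub> v)}"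

definition nontrivial_ungar_move :: "('a, 'b) gorder_scheme \<Rightarrow> 'a \<Rightarrow> 'a \<Rightarrow> bool" where
  "nontrivial_ungar_move L v u \<longleftrightarrow>
     (\<exists>T. T \<subseteq> lower_covers L v \<and> T \<noteq> {} \<and> u = \<Sqinter>\<^bsub>L\<^esub> ({v} \<union> T))"

text \<open>
  A play records the positions visited so far, the starting position first. Atniss moves first,
  so he is to move exactly when the play has odd length. Moves only go down, so every position
  of a play from \<open>v\<close> lies in the interval from the minimum of \<open>L\<close> to \<open>v\<close>, and inside that
  interval lower covers and meets are the same as in \<open>L\<close>.
\<close>

definition ungar_play :: "('a, 'b) gorder_scheme \<Rightarrow> 'a \<Rightarrow> 'a list \<Rightarrow> bool" where
  "ungar_play L v p \<longleftrightarrow> p \<noteq> [] \<and> hd p = v \<and> successively (nontrivial_ungar_move L) p"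

definition stuck :: "('a, 'b) gorder_scheme \<Rightarrow> 'a \<Rightarrow> bool" where
  "stuck L u \<longleftrightarrow> \<not> (\<exists>w. nontrivial_ungar_move L u w)"

definition complete_play :: "('a, 'b) gorder_scheme \<Rightarrow> 'a \<Rightarrow> 'a list \<Rightarrow> bool" where
  "complete_play L v p \<longleftrightarrow> ungar_play L v p \<and> stuck L (last p)"

text \<open>
  A strategy for Atniss maps the play so far to the next position; its values matter only on
  plays in which Atniss is to move and is able to.
\<close>

definition atniss_strategy ::
    "('a, 'b) gorder_scheme \<Rightarrow> 'a \<Rightarrow> ('a list \<Rightarrow> 'a) \<Rightarrow> bool" where
  "atniss_strategy L v \<sigma> \<longleftrightarrow>
     (\<forall>p. ungar_play L v p \<and> odd (length p) \<and> \<not> stuck L (last p) \<longrightarrow>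
          nontrivial_ungar_move L (last p) (\<sigma> p))"

definition follows :: "('a list \<Rightarrow> 'a) \<Rightarrow> 'a list \<Rightarrow> bool" where
  "follows \<sigma> p \<longleftrightarrow> (\<forall>k. odd k \<and> k < length p \<longrightarrow> p ! k = \<sigma> (take k p))"

text \<open>
  Atniss wins a complete play iff Eeta is the player who is stuck, i.e. iff its length is even.
\<close>

definition atniss_win :: "('a, 'b) gorder_scheme \<Rightarrow> 'a \<Rightarrow> bool" where
  "atniss_win L v \<longleftrightarrow>
     (\<exists>\<sigma>. atniss_strategy L v \<sigma> \<and>
          (\<forall>p. complete_play L v p \<and> follows \<sigma> p \<longrightarrow> even (length p)))"

definition eeta_win :: "('a, 'b) gorder_scheme \<Rightarrow> 'a \<Rightarrow> bool" where
  "eeta_win L v \<longleftrightarrow> \<not> atniss_win L v"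


section \<open>Order ideals of the shifted staircase\<close>

definition order_ideals :: "('a, 'b) gorder_scheme \<Rightarrow> 'a set set" where
  "order_ideals P =
     {I. I \<subseteq> carrier P \<and> (\<forall>x\<in>I. \<forall>y\<in>carrier P. y \<sqsubseteq>\<^bsub>P\<^esub> x \<longrightarrow> y \<in> I)}"

definition ideal_lattice :: "('a, 'b) gorder_scheme \<Rightarrow> 'a set gorder" where
  "ideal_lattice P = \<lparr>carrier = order_ideals P, eq = (=), le = (\<subseteq>)\<rparr>"

definition shifted_staircase :: "nat \<Rightarrow> (nat \<times> nat) gorder" where
  "shifted_staircase n =
     \<lparr>carrier = {(i, j). 1 \<le> i \<and> i \<le> j \<and> j \<le> n},
      eq = (=),
      le = (\<lambda>(i, j) (i', j'). i \<le> i' \<and> j \<le> j')\<rparr>"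

lemma partial_order_ideal_lattice: "partial_order (ideal_lattice P)"
  by unfold_locales (auto simp: ideal_lattice_def)

lemma greatest_Inter_ideal_lattice:
  assumes "A \<subseteq> order_ideals P" "A \<noteq> {}"
  shows "greatest (ideal_lattice P) (\<Inter>A) (Lower (ideal_lattice P) A)"
  using assms unfolding greatest_def Lower_def ideal_lattice_def order_ideals_def
  by simp blast

lemma inf_ideal_lattice:
  assumes "A \<subseteq> order_ideals P" "A \<noteq> {}"
  shows "\<Sqinter>\<^bsub>ideal_lattice P\<^esub> A = \<Inter>A"
proof -
  interpret partial_order "ideal_lattice P"
    by (rule partial_order_ideal_lattice)
  show ?thesis
    unfolding inf_def
    using greatest_Inter_ideal_lattice[OF assms]
    by (rule some_equality) (rule greatest_unique[OF _ greatest_Inter_ideal_lattice[OF assms]])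
qed


section \<open>Binary representations and blocks\<close>

definition row_length :: "(nat \<times> nat) set \<Rightarrow> nat \<Rightarrow> nat" where
  "row_length v i = card {j. (i, j) \<in> v}"

text \<open>
  Digits are Booleans (\<open>True\<close> for 1). Lists are indexed from 0, so \<open>s\<^sub>k\<close> is entry
  \<open>k - 1\<close>.
\<close>

definition binary_rep :: "nat \<Rightarrow> (nat \<times> nat) set \<Rightarrow> bool list" where
  "binary_rep n v = map (\<lambda>k. \<exists>i\<in>{1..n}. row_length v i = n - k + 1) [1..<n + 1]"

text \<open>
  A nonempty substring of \<open>s\<close> is given by the half-open range \<open>{a..<c}\<close> of its 0-based
  positions; its length is \<open>c - a\<close>.
\<close>

definition constant_substring :: "'a \<Rightarrow> 'a list \<Rightarrow> nat \<Rightarrow> nat \<Rightarrow> bool" where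
  "constant_substring b s a c \<longleftrightarrow> a < c \<and> c \<le> length s \<and> (\<forall>k\<in>{a..<c}. s ! k = b)"

definition maximal_block :: "'a \<Rightarrow> 'a list \<Rightarrow> nat \<Rightarrow> nat \<Rightarrow> bool" where
  "maximal_block b s a c \<longleftrightarrow>
     constant_substring b s a c \<and>
     (\<forall>a' c'. constant_substring b s a' c' \<and> {a..<c} \<subseteq> {a'..<c'} \<longrightarrow> a' = a \<and> c' = c)"

end

theory Submission
  imports Defs
begin

text \<open>
  An Ungar move on a word picks a nonempty set of disjoint sites, each an occurrence of 10 or a
  final 1, and rewrites them simultaneously to 01 and 0. The words satisfying (i) and (ii) form a
  regular language, and a move is a letter-to-letter transduction with one bit of memory (whether
  the previous letter was chosen), so both halves of the theorem become invariants of a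
  left-to-right scan with finitely many states. A nontrivial move leaves the language because the
  pair of automaton states of the old and the new word can never be accepting on both sides once a
  site has been chosen. Conversely, the set of automaton states that moves can produce on each
  prefix always contains enough states to end in an accepting one unless the old word was itself
  accepted.
\<close>

section \<open>The game\<close>

lemma ungar_play_snoc:
  assumes "ungar_play L v p" "nontrivial_ungar_move L (last p) u"
  shows "ungar_play L v (p @ [u])"
  using assms by (auto simp: ungar_play_def successively_append_iff)

lemma ungar_play_butlast:
  assumes "ungar_play L v (p @ [u])" "p \<noteq> []"
  shows "ungar_play L v p \<and> nontrivial_ungar_move L (last p) u"
  using assms by (auto simp: ungar_play_def successively_append_iff)

lemma follows_snoc:
  "follows \<sigma> (p @ [u]) \<longleftrightarrow> follows \<sigma> p \<and> (odd (length p) \<longrightarrow> u = \<sigma> p)"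
  unfolding follows_def by (auto simp: nth_append less_Suc_eq)

text \<open>\<open>K\<close> is a kernel of the move graph: no move joins two positions of
  \<open>K\<close>, and every position outside has a move into it. Whoever moves into
  \<open>K\<close> can do so at every later turn. The measure \<open>f\<close> makes play finite,
  which is how a complete play defeating a given strategy of Atniss is produced.\<close>

lemma eeta_win_iff:
  fixes f :: "'a \<Rightarrow> nat"
  assumes closed: "\<And>v u. v \<in> C \<Longrightarrow> nontrivial_ungar_move L v u \<Longrightarrow> u \<in> C"
    and decreasing: "\<And>v u. v \<in> C \<Longrightarrow> nontrivial_ungar_move L v u \<Longrightarrow> f u < f v"
    and leave: "\<And>v u. v \<in> C \<Longrightarrow> K v \<Longrightarrow> nontrivial_ungar_move L v u \<Longrightarrow> \<not> K u"
    and enter: "\<And>v. v \<in> C \<Longrightarrow> \<not> K v \<Longrightarrow> \<exists>u. nontrivial_ungar_move L v u \<and> K u"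
    and v: "v \<in> C"
  shows "eeta_win L v \<longleftrightarrow> K v"
proof
  assume "eeta_win L v"
  show "K v"
  proof (rule ccontr)
    assume nK: "\<not> K v"
    \<comment> \<open>Move into \<open>K\<close> when possible and otherwise make any move: a
      strategy must be legal also on plays that it would never produce.\<close>
    define \<sigma> where "\<sigma> p = (SOME u. nontrivial_ungar_move L (last p) u \<and>
      ((\<exists>w. nontrivial_ungar_move L (last p) w \<and> K w) \<longrightarrow> K u))" for p
    have \<sigma>: "nontrivial_ungar_move L (last p) (\<sigma> p) \<and>
        ((\<exists>w. nontrivial_ungar_move L (last p) w \<and> K w) \<longrightarrow> K (\<sigma> p))"
      if "\<not> stuck L (last p)" for p
      unfolding \<sigma>_def by (rule someI_ex) (use that in \<open>auto simp: stuck_def\<close>)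
    have strategy: "atniss_strategy L v \<sigma>"
      using \<sigma> by (auto simp: atniss_strategy_def)
    \<comment> \<open>From a start outside \<open>K\<close>, Atniss always faces a position outside
      \<open>K\<close> and Eeta one inside.\<close>
    have inv: "last p \<in> C \<and> (K (last p) \<longleftrightarrow> even (length p))"
      if "ungar_play L v p" "follows \<sigma> p" for p
      using that
    proof (induction p rule: rev_induct)
      case Nil
      then show ?case by (simp add: ungar_play_def)
    next
      case (snoc u p)
      show ?case
      proof (cases "p = []")
        case True
        with snoc.prems nK v show ?thesis by (simp add: ungar_play_def)
      next
        case False
        have play: "ungar_play L v p" and move: "nontrivial_ungar_move L (last p) u"
          using ungar_play_butlast[OF snoc.prems(1) False] by auto
        have fol: "follows \<sigma> p" "odd (length p) \<Longrightarrow> u = \<sigma> p"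
          using snoc.prems(2) by (auto simp: follows_snoc)
        have IH: "last p \<in> C" "K (last p) \<longleftrightarrow> even (length p)"
          using snoc.IH play fol(1) by auto
        have "K u" if "odd (length p)"
          using \<sigma>[of p] enter[OF IH(1)] IH(2) fol(2) that move by (auto simp: stuck_def)
        moreover have "\<not> K u" if "even (length p)"
          using leave[OF IH(1) _ move] IH(2) that by auto
        ultimately show ?thesis
          using closed[OF IH(1) move] by auto
      qed
    qed
    have "atniss_win L v"
      unfolding atniss_win_def
    proof (intro exI conjI allI impI)
      fix p assume p: "complete_play L v p \<and> follows \<sigma> p"
      with inv[of p] have "last p \<in> C" "K (last p) \<longleftrightarrow> even (length p)"
        by (auto simp: complete_play_def)
      \<comment> \<open>A stuck position lies in \<open>K\<close>, since every position outside
        \<open>K\<close> has a move; so Eeta is the one to move there.\<close>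
      with enter[of "last p"] p show "even (length p)"
        by (auto simp: complete_play_def stuck_def)
    qed (rule strategy)
    with \<open>eeta_win L v\<close> show False by (simp add: eeta_win_def)
  qed
next
  assume "K v"
  show "eeta_win L v"
    unfolding eeta_win_def
  proof
    assume "atniss_win L v"
    then obtain \<sigma> where \<sigma>: "atniss_strategy L v \<sigma>"
      and win: "\<And>p. complete_play L v p \<Longrightarrow> follows \<sigma> p \<Longrightarrow> even (length p)"
      by (auto simp: atniss_win_def)
    \<comment> \<open>A play ending in \<open>K\<close> with Atniss to move is either lost for him
      or can be extended by his move and a reply back into \<open>K\<close>.\<close>
    have "\<exists>q. complete_play L v q \<and> follows \<sigma> q \<and> odd (length q)"
      if "ungar_play L v p" "follows \<sigma> p" "odd (length p)" "last p \<in> C" "K (last p)" for p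
      using that
    proof (induction "f (last p)" arbitrary: p rule: less_induct)
      case less
      show ?case
      proof (cases "stuck L (last p)")
        case True
        with less.prems show ?thesis by (auto simp: complete_play_def)
      next
        case False
        define u where "u = \<sigma> p"
        have move: "nontrivial_ungar_move L (last p) u"
          using \<sigma> less.prems False by (auto simp: atniss_strategy_def u_def)
        have u: "u \<in> C" "\<not> K u" "f u < f (last p)"
          using closed[OF _ move] leave[OF _ _ move] decreasing[OF _ move] less.prems by auto
        obtain w where w: "nontrivial_ungar_move L u w" "K w"
          using enter u by blast
        show ?thesis
        proof (rule less.hyps[of "p @ [u] @ [w]"])
          show "f (last (p @ [u] @ [w])) < f (last p)"
            using decreasing[OF u(1) w(1)] u(3) by simp
          show "ungar_play L v (p @ [u] @ [w])"
            using ungar_play_snoc[of L v "p @ [u]" w] ungar_play_snoc[OF less.prems(1) move] w(1)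
            by simp
          show "follows \<sigma> (p @ [u] @ [w])"
            using less.prems follows_snoc[of \<sigma> "p @ [u]" w] follows_snoc[of \<sigma> p u]
            by (simp add: u_def)
        qed (use less.prems w closed[OF u(1) w(1)] in auto)
      qed
    qed
    from this[of "[v]"] \<open>K v\<close> v win show False
      by (auto simp: ungar_play_def follows_def)
  qed
qed


section \<open>Moves in a lattice of order ideals\<close>

definition maximal_elements :: "('a, 'b) gorder_scheme \<Rightarrow> 'a set \<Rightarrow> 'a set" where
  "maximal_elements P v = {x \<in> v. \<forall>y\<in>v. x \<sqsubseteq>\<^bsub>P\<^esub> y \<longrightarrow> y = x}"

lemma diff_maximal_elements_in_order_ideals:
  assumes "v \<in> order_ideals P" "X \<subseteq> maximal_elements P v"
  shows "v - X \<in> order_ideals P"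
  using assms by (fastforce simp: order_ideals_def maximal_elements_def)

text \<open>Take \<open>x\<close> in \<open>v - u\<close> with the fewest elements above it. A
  larger element of \<open>v\<close> would also avoid the ideal \<open>u\<close> and have strictly
  fewer elements above it.\<close>

lemma (in partial_order) exists_maximal_element_diff:
  assumes "finite (carrier L)" "v \<in> order_ideals L" "u \<in> order_ideals L" "u \<subset> v"
  shows "\<exists>x\<in>maximal_elements L v. x \<notin> u"
proof -
  have sub: "v \<subseteq> carrier L"
    using assms by (auto simp: order_ideals_def)
  define d where "d x = card {y \<in> carrier L. x \<sqsubseteq> y}" for x
  obtain x where x: "x \<in> v - u" and min: "\<And>y. y \<in> v - u \<Longrightarrow> d x \<le> d y"
    using assms(4) ex_has_least_nat[of "\<lambda>x. x \<in> v - u" _ d] by blast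
  have "y = x" if y: "y \<in> v" "x \<sqsubseteq> y" for y
  proof (rule ccontr)
    assume "y \<noteq> x"
    have C: "x \<in> carrier L" "y \<in> carrier L" using x y sub by auto
    have "y \<notin> u" using assms(3) C x y by (auto simp: order_ideals_def)
    moreover have "{z \<in> carrier L. y \<sqsubseteq> z} \<subset> {z \<in> carrier L. x \<sqsubseteq> z}"
    proof
      show "{z \<in> carrier L. y \<sqsubseteq> z} \<subseteq> {z \<in> carrier L. x \<sqsubseteq> z}"
        using C y le_trans by blast
      have "x \<in> {z \<in> carrier L. x \<sqsubseteq> z} - {z \<in> carrier L. y \<sqsubseteq> z}"
        using C y \<open>y \<noteq> x\<close> le_antisym[of x y] by (auto simp: eq_is_equal)
      then show "{z \<in> carrier L. y \<sqsubseteq> z} \<noteq> {z \<in> carrier L. x \<sqsubseteq> z}" by blast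
    qed
    then have "d y < d x"
      unfolding d_def using assms(1) by (intro psubset_card_mono) auto
    ultimately show False using min[of y] y by simp
  qed
  then show ?thesis
    using x by (auto simp: maximal_elements_def)
qed

text \<open>An ideal \<open>u\<close> strictly below \<open>v\<close> misses some maximal element
  \<open>x\<close> of \<open>v\<close>, so the ideal \<open>v - {x}\<close> lies between
  \<open>u\<close> and \<open>v\<close>; a cover must equal it.\<close>

lemma (in partial_order) lower_covers_ideal_lattice:
  assumes "finite (carrier L)" "v \<in> order_ideals L"
  shows "lower_covers (ideal_lattice L) v = (\<lambda>x. v - {x}) ` maximal_elements L v"
proof -
  have lless: "u \<sqsubset>\<^bsub>ideal_lattice L\<^esub> w \<longleftrightarrow> u \<subset> w" for u w
    by (auto simp: lless_def ideal_lattice_def)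
  have lc: "lower_covers (ideal_lattice L) v =
      {u \<in> order_ideals L. u \<subset> v \<and> \<not> (\<exists>w\<in>order_ideals L. u \<subset> w \<and> w \<subset> v)}"
    unfolding lower_covers_def lless by (simp add: ideal_lattice_def)
  have del: "v - {x} \<in> order_ideals L" if "x \<in> maximal_elements L v" for x
    using diff_maximal_elements_in_order_ideals[OF assms(2), of "{x}"] that by simp
  have mem: "x \<in> v" if "x \<in> maximal_elements L v" for x
    using that by (simp add: maximal_elements_def)
  show ?thesis
    unfolding lc
  proof (intro equalityI subsetI)
    fix u assume "u \<in> {u \<in> order_ideals L. u \<subset> v \<and> \<not> (\<exists>w\<in>order_ideals L. u \<subset> w \<and> w \<subset> v)}"
    then have u: "u \<in> order_ideals L" "u \<subset> v" "\<And>w. w \<in> order_ideals L \<Longrightarrow> u \<subset> w \<Longrightarrow> \<not> w \<subset> v"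
      by auto
    obtain x where x: "x \<in> maximal_elements L v" "x \<notin> u"
      using exists_maximal_element_diff[OF assms u(1,2)] by auto
    have "u = v - {x}"
      using u(3)[OF del[OF x(1)]] u(2) x(2) mem[OF x(1)] by blast
    then show "u \<in> (\<lambda>x. v - {x}) ` maximal_elements L v"
      using x by blast
  next
    fix u assume "u \<in> (\<lambda>x. v - {x}) ` maximal_elements L v"
    then obtain x where "x \<in> maximal_elements L v" "u = v - {x}" by auto
    then show "u \<in> {u \<in> order_ideals L. u \<subset> v \<and> \<not> (\<exists>w\<in>order_ideals L. u \<subset> w \<and> w \<subset> v)}"
      using del mem by blast
  qed
qed

text \<open>Meets are intersections, so meeting several lower covers deletes their missing elements
  simultaneously.\<close>

lemma (in partial_order) nontrivial_ungar_move_ideal_lattice: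
  assumes "finite (carrier L)" "v \<in> order_ideals L"
  shows "nontrivial_ungar_move (ideal_lattice L) v u \<longleftrightarrow>
    (\<exists>X. X \<subseteq> maximal_elements L v \<and> X \<noteq> {} \<and> u = v - X)"
proof -
  have inf: "\<Sqinter>\<^bsub>ideal_lattice L\<^esub> ({v} \<union> (\<lambda>x. v - {x}) ` X) = v - X"
    if "X \<subseteq> maximal_elements L v" for X
  proof -
    have "{v} \<union> (\<lambda>x. v - {x}) ` X \<subseteq> order_ideals L"
      using that assms(2) diff_maximal_elements_in_order_ideals[OF assms(2), of "{_}"] by blast
    from inf_ideal_lattice[OF this] show ?thesis by auto
  qed
  show ?thesis
  proof
    assume "nontrivial_ungar_move (ideal_lattice L) v u"
    then obtain T where T: "T \<subseteq> (\<lambda>x. v - {x}) ` maximal_elements L v" "T \<noteq> {}"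
      and u: "u = \<Sqinter>\<^bsub>ideal_lattice L\<^esub> ({v} \<union> T)"
      unfolding nontrivial_ungar_move_def lower_covers_ideal_lattice[OF assms] by auto
    obtain X where X: "X \<subseteq> maximal_elements L v" "T = (\<lambda>x. v - {x}) ` X"
      using T(1) by (auto simp: subset_image_iff)
    have "X \<noteq> {}" using X(2) T(2) by auto
    with X u inf[OF X(1)]
    show "\<exists>X. X \<subseteq> maximal_elements L v \<and> X \<noteq> {} \<and> u = v - X" by auto
  next
    assume "\<exists>X. X \<subseteq> maximal_elements L v \<and> X \<noteq> {} \<and> u = v - X"
    then obtain X where X: "X \<subseteq> maximal_elements L v" "X \<noteq> {}" "u = v - X" by auto
    show "nontrivial_ungar_move (ideal_lattice L) v u"
      unfolding nontrivial_ungar_move_def lower_covers_ideal_lattice[OF assms]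
    proof (intro exI conjI)
      show "u = \<Sqinter>\<^bsub>ideal_lattice L\<^esub> ({v} \<union> (\<lambda>x. v - {x}) ` X)"
        using inf[OF X(1)] X(3) by simp
    qed (use X in auto)
  qed
qed


section \<open>Words\<close>

text \<open>
  A word of length \<open>n\<close> is the set of the 0-based positions of its 1s. The states \<open>Odd_Zeros\<close> and
  \<open>Even_Zeros\<close> occur only in a block of 0s that follows an odd block of 1s; any other block of 0s
  is harmless and leads to \<open>Fresh\<close>. The last letter needs no special treatment: a word that ends
  in 0 is good iff the scan of its other letters avoids \<open>Odd_Zeros\<close> and \<open>Bad\<close>, which means that
  the whole scan ends in \<open>Fresh\<close> or \<open>Odd_Zeros\<close>.
\<close>

datatype state = Fresh | Odd_Ones | Even_Ones | Odd_Zeros | Even_Zeros | Bad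

fun next_state :: "state \<Rightarrow> bool \<Rightarrow> state" where
  "next_state Fresh x = (if x then Odd_Ones else Fresh)"
| "next_state Odd_Ones x = (if x then Even_Ones else Odd_Zeros)"
| "next_state Even_Ones x = (if x then Odd_Ones else Fresh)"
| "next_state Odd_Zeros x = (if x then Bad else Even_Zeros)"
| "next_state Even_Zeros x = (if x then Odd_Ones else Odd_Zeros)"
| "next_state Bad x = Bad"

primrec state_at :: "nat set \<Rightarrow> nat \<Rightarrow> state" where
  "state_at S 0 = Fresh"
| "state_at S (Suc k) = next_state (state_at S k) (k \<in> S)"

abbreviation accepting :: "state \<Rightarrow> bool" where
  "accepting q \<equiv> q \<in> {Fresh, Odd_Zeros}"

lemma state_at_cong:
  "S \<inter> {..<k} = T \<inter> {..<k} \<Longrightarrow> state_at S k = state_at T k"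
proof (induction k)
  case (Suc k)
  have "S \<inter> {..<k} = T \<inter> {..<k}" "k \<in> S \<longleftrightarrow> k \<in> T"
    using Suc.prems by (auto simp: lessThan_Suc)
  with Suc.IH show ?case by simp
qed simp

section \<open>Moves on words, and why they leave the accepted words\<close>

definition word_move :: "nat \<Rightarrow> nat set \<Rightarrow> nat set \<Rightarrow> bool" where
  "word_move n S B \<longleftrightarrow> (\<forall>j\<in>B. j < n \<and> j \<in> S \<and> (Suc j < n \<longrightarrow> Suc j \<notin> S))"

text \<open>A chosen final 1 at position \<open>n - 1\<close> is sent to position \<open>n\<close>,
  outside the word. This encodes its replacement by 0, because \<open>state_at _ n\<close> reads
  only positions below \<open>n\<close>.\<close>

definition moved :: "nat set \<Rightarrow> nat set \<Rightarrow> nat set" where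
  "moved S B = (S - B) \<union> Suc ` B"

text \<open>
  \<open>spoiled q r p\<close> lists the pairs of states \<open>q\<close> of the old and \<open>r\<close> of the new word that can
  occur once a site has been chosen; \<open>p\<close> says that the last letter read was chosen, so that its
  1 is still to be written in the next position.
\<close>

fun spoiled :: "state \<Rightarrow> state \<Rightarrow> bool \<Rightarrow> bool" where
  "spoiled Fresh r p \<longleftrightarrow> r = Bad"
| "spoiled Odd_Ones r p \<longleftrightarrow> r = Bad \<or> p \<and> r \<in> {Fresh, Odd_Zeros, Even_Zeros}"
| "spoiled Even_Ones r p \<longleftrightarrow> r = Bad \<or> p \<and> r = Odd_Zeros"
| "spoiled Odd_Zeros r p \<longleftrightarrow> r = Bad \<or> \<not> p \<and> r \<in> {Even_Zeros, Odd_Ones}"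
| "spoiled Even_Zeros r p \<longleftrightarrow> r = Bad \<or> \<not> p \<and> r = Odd_Zeros"
| "spoiled Bad r p \<longleftrightarrow> True"

text \<open>The first chosen site: up to it both scans share the state \<open>q\<close>; there the
  old word has 1 and the new word 0, with a 1 pending.\<close>

lemma spoiled_start: "spoiled (next_state q True) (next_state q False) True"
  by (cases q) auto

text \<open>Here \<open>x\<close> is the old letter, \<open>b\<close> says that it is chosen, and
  the new letter is 1 iff an unchosen 1 stays or a pending 1 arrives.\<close>

lemma spoiled_step:
  assumes "spoiled q r p" "b \<Longrightarrow> x" "p \<Longrightarrow> \<not> x"
  shows "spoiled (next_state q x) (next_state r (x \<and> \<not> b \<or> p)) b"
  using assms by (cases q; cases x; cases b; cases p; auto)

lemma word_move_spoils:
  assumes "word_move n S B" "k \<le> n"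
  shows "if B \<inter> {..<k} = {} then state_at (moved S B) k = state_at S k
    else spoiled (state_at S k) (state_at (moved S B) k) (k \<in> Suc ` B)"
  using assms(2)
proof (induction k)
  case (Suc k)
  have k: "k < n" using Suc.prems by simp
  have disj: "k \<in> B \<Longrightarrow> k \<in> S" "k \<in> Suc ` B \<Longrightarrow> k \<notin> S"
    using assms(1) k by (auto simp: word_move_def)
  have mem: "k \<in> moved S B \<longleftrightarrow> k \<in> S \<and> k \<notin> B \<or> k \<in> Suc ` B"
    by (simp add: moved_def)
  have pend: "Suc k \<in> Suc ` B \<longleftrightarrow> k \<in> B"
    by auto
  have below: "B \<inter> {..<Suc k} = {} \<longleftrightarrow> B \<inter> {..<k} = {} \<and> k \<notin> B"
    by (auto simp: less_Suc_eq)
  show ?case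
  proof (cases "B \<inter> {..<k} = {}")
    case True
    then have "k \<notin> Suc ` B" by auto
    then show ?thesis
      using True Suc disj spoiled_start unfolding state_at.simps mem pend below by auto
  next
    case False
    then show ?thesis
      using Suc spoiled_step[OF _ disj] unfolding state_at.simps mem pend below by simp
  qed
qed simp

text \<open>For accepting \<open>q\<close>, the relation \<open>spoiled q r p\<close> leaves only
  \<open>Bad\<close>, \<open>Even_Zeros\<close> and \<open>Odd_Ones\<close> for \<open>r\<close>,
  none of which accepts.\<close>

lemma leave_accepting:
  assumes "word_move n S B" "B \<noteq> {}" "accepting (state_at S n)"
  shows "\<not> accepting (state_at (moved S B) n)"
proof -
  have "B \<inter> {..<n} \<noteq> {}" using assms by (auto simp: word_move_def)
  then show ?thesis
    using word_move_spoils[OF assms(1) order_refl] assms(3) by auto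
qed

section \<open>Moves into the accepted words\<close>

definition reachable :: "nat set \<Rightarrow> nat \<Rightarrow> state \<Rightarrow> bool \<Rightarrow> bool" where
  "reachable S k q p \<longleftrightarrow>
     (\<exists>B. word_move k S B \<and> state_at (moved S B) k = q \<and> (k \<in> Suc ` B \<longleftrightarrow> p))"

text \<open>In \<open>reachable\<close> the prefix counts as a word of its own, so its last 1 may be
  chosen before letter \<open>k\<close> is known. A pending 1 then requires the old letter
  \<open>k\<close> to be 0 and takes its place.\<close>

lemma reachable_stay:
  assumes "reachable S k q p" "p \<Longrightarrow> k \<notin> S"
  shows "reachable S (Suc k) (next_state q (k \<in> S \<or> p)) False"
proof -
  obtain B where B: "word_move k S B" "state_at (moved S B) k = q" "k \<in> Suc ` B \<longleftrightarrow> p"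
    using assms by (auto simp: reachable_def)
  have "k \<notin> B" using B(1) by (auto simp: word_move_def)
  have "word_move (Suc k) S B"
    using B assms(2) by (auto simp: word_move_def less_Suc_eq)
  moreover have "k \<in> moved S B \<longleftrightarrow> k \<in> S \<or> p"
    using B(3) \<open>k \<notin> B\<close> by (auto simp: moved_def)
  ultimately show ?thesis
    unfolding reachable_def using B(2) \<open>k \<notin> B\<close> by (intro exI[of _ B]) auto
qed

lemma reachable_move:
  assumes "reachable S k q False" "k \<in> S"
  shows "reachable S (Suc k) (next_state q False) True"
proof -
  obtain B where B: "word_move k S B" "state_at (moved S B) k = q" "k \<notin> Suc ` B"
    using assms by (auto simp: reachable_def)
  have "k \<notin> B" using B(1) by (auto simp: word_move_def)
  have "word_move (Suc k) S (insert k B)"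
    using B assms(2) by (auto simp: word_move_def less_Suc_eq)
  moreover have "k \<notin> moved S (insert k B)"
    using B(3) by (auto simp: moved_def)
  \<comment> \<open>Choosing \<open>k\<close> as well alters only the positions \<open>k\<close> and
    \<open>Suc k\<close>, which the scan up to \<open>k\<close> has not read.\<close>
  moreover have "state_at (moved S (insert k B)) k = state_at (moved S B) k"
    by (rule state_at_cong) (auto simp: moved_def)
  ultimately show ?thesis
    unfolding reachable_def using B(2) by (intro exI[of _ "insert k B"]) auto
qed

text \<open>The disjunctions were found by the subset construction, keeping only minimal sets of states.\<close>

lemma reachable_states:
  "case state_at S k of
     Fresh \<Rightarrow> reachable S k Fresh False
   | Odd_Ones \<Rightarrow> reachable S k Odd_Ones False \<and>
       (reachable S k Fresh True \<or> reachable S k Even_Zeros True \<and> reachable S k Odd_Zeros True)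
   | Even_Ones \<Rightarrow> reachable S k Even_Ones False \<and> reachable S k Odd_Zeros True
   | Odd_Zeros \<Rightarrow> reachable S k Odd_Zeros False \<and>
       (reachable S k Even_Zeros False \<or> reachable S k Odd_Ones False)
   | Even_Zeros \<Rightarrow> reachable S k Even_Zeros False \<and> reachable S k Odd_Zeros False
   | Bad \<Rightarrow> reachable S k Fresh False
       \<or> reachable S k Odd_Zeros True \<and> reachable S k Even_Ones False
       \<or> reachable S k Odd_Zeros False \<and> reachable S k Odd_Ones False
       \<or> reachable S k Fresh True \<and> reachable S k Odd_Ones False
       \<or> reachable S k Even_Zeros False \<and> reachable S k Odd_Zeros False
       \<or> reachable S k Even_Zeros True \<and> reachable S k Odd_Zeros True \<and> reachable S k Odd_Ones False"
proof (induction k)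
  case 0
  show ?case by (auto simp: reachable_def word_move_def)
next
  case (Suc k)
  have stay: "reachable S k q p \<Longrightarrow> k \<notin> S \<or> \<not> p \<Longrightarrow>
      next_state q (k \<in> S \<or> p) = r \<Longrightarrow> reachable S (Suc k) r False" for q r p
    using reachable_stay[of S k q p] by auto
  have move: "reachable S k q False \<Longrightarrow> k \<in> S \<Longrightarrow>
      next_state q False = r \<Longrightarrow> reachable S (Suc k) r True" for q r
    using reachable_move[of S k q] by auto
  show ?case
  proof (cases "k \<in> S")
    case True
    \<comment> \<open>Reading an old 1 rules out a pending 1, so only configurations with
      \<open>False\<close> continue, each by keeping the 1 or by choosing it. Successors in
      \<open>Bad\<close> are left out.\<close>
    have "reachable S k Fresh False \<Longrightarrow> reachable S (Suc k) Odd_Ones False \<and> reachable S (Suc k) Fresh True"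
      "reachable S k Odd_Ones False \<Longrightarrow> reachable S (Suc k) Even_Ones False \<and> reachable S (Suc k) Odd_Zeros True"
      "reachable S k Even_Ones False \<Longrightarrow> reachable S (Suc k) Odd_Ones False \<and> reachable S (Suc k) Fresh True"
      "reachable S k Odd_Zeros False \<Longrightarrow> reachable S (Suc k) Even_Zeros True"
      "reachable S k Even_Zeros False \<Longrightarrow> reachable S (Suc k) Odd_Ones False \<and> reachable S (Suc k) Odd_Zeros True"
      using stay[where p = False] move True by simp_all
    with Suc.IH True show ?thesis by (cases "state_at S k"; simp; blast)
  next
    case False
    have "reachable S k Fresh False \<Longrightarrow> reachable S (Suc k) Fresh False"
      "reachable S k Odd_Ones False \<Longrightarrow> reachable S (Suc k) Odd_Zeros False"
      "reachable S k Even_Ones False \<Longrightarrow> reachable S (Suc k) Fresh False"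
      "reachable S k Odd_Zeros False \<Longrightarrow> reachable S (Suc k) Even_Zeros False"
      "reachable S k Even_Zeros False \<Longrightarrow> reachable S (Suc k) Odd_Zeros False"
      "reachable S k Fresh True \<Longrightarrow> reachable S (Suc k) Odd_Ones False"
      "reachable S k Even_Zeros True \<Longrightarrow> reachable S (Suc k) Odd_Ones False"
      "reachable S k Odd_Zeros True \<Longrightarrow> reachable S (Suc k) Bad False"
      using stay False by simp_all
    with Suc.IH False show ?thesis by (cases "state_at S k"; simp; blast)
  qed
qed

text \<open>In \<open>reachable_states\<close>, every alternative listed for a non-accepting state
  offers \<open>Fresh\<close> or \<open>Odd_Zeros\<close>. A 1 still pending at the end is harmless:
  it comes from a chosen final 1.\<close>

lemma enter_accepting:
  assumes "\<not> accepting (state_at S n)"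
  shows "\<exists>B. word_move n S B \<and> accepting (state_at (moved S B) n)"
proof -
  have "\<exists>q p. accepting q \<and> reachable S n q p"
    using reachable_states[of S n] assms by (cases "state_at S n") auto
  then show ?thesis by (auto simp: reachable_def)
qed

section \<open>Runs of equal letters: from states of the scan to maximal blocks\<close>

primrec run :: "bool \<Rightarrow> nat set \<Rightarrow> nat \<Rightarrow> nat" where
  "run b S 0 = 0"
| "run b S (Suc k) = (if (k \<in> S) = b then Suc (run b S k) else 0)"

lemma run_le: "run b S k \<le> k"
  by (induction k) auto

lemma in_run: "k - run b S k \<le> j \<Longrightarrow> j < k \<Longrightarrow> (j \<in> S) = b"
proof (induction k)
  case (Suc k)
  show ?case
  proof (cases "(k \<in> S) = b")
    case True
    with Suc.prems Suc.IH show ?thesis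
      by (cases "j = k") auto
  next
    case False
    with Suc.prems show ?thesis by simp
  qed
qed simp

lemma before_run: "run b S k < k \<Longrightarrow> (k - run b S k - 1 \<in> S) \<noteq> b"
proof (induction k)
  case (Suc k)
  show ?case
  proof (cases "(k \<in> S) = b")
    case True
    with Suc show ?thesis by simp
  qed simp
qed simp

lemma run_eqI:
  assumes "a \<le> k" "\<And>j. a \<le> j \<Longrightarrow> j < k \<Longrightarrow> (j \<in> S) = b" "a > 0 \<Longrightarrow> (a - 1 \<in> S) \<noteq> b"
  shows "run b S k = k - a"
proof (rule ccontr)
  assume ne: "run b S k \<noteq> k - a"
  show False
  proof (cases "run b S k < k - a")
    case True
    then have "a \<le> k - run b S k - 1" by linarith
    with True show False
      using before_run[of b S k] assms(2)[of "k - run b S k - 1"] by auto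
  next
    case False
    then have "run b S k > k - a" using ne by simp
    then have "k - run b S k \<le> a - 1" "a - 1 < k" "a > 0"
      using assms(1) run_le[of b S k] by linarith+
    then show False
      using in_run[of k b S "a - 1"] assms(3) by simp
  qed
qed

text \<open>Closed form of the scan. \<open>Bad\<close> records a 1 at some \<open>c\<close> that
  closes an odd run of 0s preceded by an odd run of 1s; otherwise the last one or two runs decide.
  For a word of 0s alone, \<open>run True S 0 = 0\<close> is even and gives
  \<open>Fresh\<close>.\<close>

lemma state_at_eq:
  "state_at S k =
    (if \<exists>c<k. c \<in> S \<and> odd (run False S c) \<and> odd (run True S (c - run False S c)) then Bad
     else if run True S k > 0 then (if odd (run True S k) then Odd_Ones else Even_Ones)
     else if odd (run True S (k - run False S k))
       then (if odd (run False S k) then Odd_Zeros else Even_Zeros)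
     else Fresh)"
proof (induction k)
  case (Suc k)
  have [simp]: "(\<exists>c<Suc k. P c) \<longleftrightarrow> (\<exists>c<k. P c) \<or> P k" for P
    by (auto simp: less_Suc_eq)
  have [simp]: "run False S k = 0" if "run True S k > 0"
    using that by (cases k) (auto split: if_splits)
  show ?case
    using Suc by auto
qed simp

text \<open>The run length ending at \<open>c\<close> encodes maximality to the left, the letter at
  \<open>c\<close> (if there is one) maximality to the right.\<close>

lemma maximal_block_iff_run:
  assumes "\<And>k. k < length s \<Longrightarrow> s ! k \<longleftrightarrow> k \<in> S"
  shows "maximal_block b s a c \<longleftrightarrow>
    a < c \<and> c \<le> length s \<and> run b S c = c - a \<and> (c < length s \<longrightarrow> (c \<in> S) \<noteq> b)"
proof
  assume m: "maximal_block b s a c"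
  then have "constant_substring b s a c" by (simp add: maximal_block_def)
  then have c: "a < c" "c \<le> length s" and in_block: "\<And>j. a \<le> j \<Longrightarrow> j < c \<Longrightarrow> (j \<in> S) = b"
    using assms by (auto simp: constant_substring_def)
  have max: "\<And>a' c'. constant_substring b s a' c' \<Longrightarrow> {a..<c} \<subseteq> {a'..<c'} \<Longrightarrow> a' = a \<and> c' = c"
    using m by (simp add: maximal_block_def)
  have "(a - 1 \<in> S) \<noteq> b" if "a > 0"
  proof
    assume "(a - 1 \<in> S) = b"
    then have "(j \<in> S) = b" if "a - 1 \<le> j" "j < c" for j
      using in_block[of j] that by (cases "j = a - 1") auto
    then have "constant_substring b s (a - 1) c"
      using c assms by (auto simp: constant_substring_def)
    from max[OF this] that show False by auto
  qed
  then have "run b S c = c - a"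
    using c in_block by (intro run_eqI) auto
  moreover have "(c \<in> S) \<noteq> b" if "c < length s"
  proof
    assume "(c \<in> S) = b"
    then have "(j \<in> S) = b" if "a \<le> j" "j < Suc c" for j
      using in_block[of j] that by (cases "j = c") auto
    then have "constant_substring b s a (Suc c)"
      using c assms that by (auto simp: constant_substring_def)
    from max[OF this] show False by auto
  qed
  ultimately show "a < c \<and> c \<le> length s \<and> run b S c = c - a \<and> (c < length s \<longrightarrow> (c \<in> S) \<noteq> b)"
    using c by blast
next
  assume r: "a < c \<and> c \<le> length s \<and> run b S c = c - a \<and> (c < length s \<longrightarrow> (c \<in> S) \<noteq> b)"
  have "constant_substring b s a c"
    using r in_run[of c b S] assms by (auto simp: constant_substring_def)
  moreover have "a' = a \<and> c' = c"
    if "constant_substring b s a' c'" "{a..<c} \<subseteq> {a'..<c'}" for a' c'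
  proof -
    have "a \<in> {a'..<c'}" "c - 1 \<in> {a'..<c'}"
      using that(2) r by auto
    then have "a' \<le> a" "c \<le> c'" by auto
    have in_block: "(j \<in> S) = b" if "a' \<le> j" "j < c'" for j
      using \<open>constant_substring b s a' c'\<close> that assms[of j] by (auto simp: constant_substring_def)
    have "c' \<le> length s" using that by (auto simp: constant_substring_def)
    have "\<not> a' < a"
    proof
      assume "a' < a"
      then have "a' \<le> a - 1" "a - 1 < c'" using r \<open>c \<le> c'\<close> by linarith+
      then show False
        using in_block[of "a - 1"] before_run[of b S c] r \<open>a' < a\<close> by auto
    qed
    moreover have "\<not> c < c'"
      using in_block[of c] r \<open>a' \<le> a\<close> \<open>c' \<le> length s\<close> by auto
    ultimately show ?thesis using \<open>a' \<le> a\<close> \<open>c \<le> c'\<close> by simp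
  qed
  ultimately show "maximal_block b s a c"
    by (auto simp: maximal_block_def)
qed

text \<open>The end \<open>c\<close> of the block of 0s determines both blocks. If \<open>c\<close>
  is inside the word, the 1 found there has sent the scan to \<open>Bad\<close>; if \<open>c\<close>
  is the end of the word, the scan stops in \<open>Odd_Zeros\<close> unless it is already in
  \<open>Bad\<close>.\<close>

lemma odd_blocks_iff_state_at:
  assumes "\<And>k. k < length s \<Longrightarrow> s ! k \<longleftrightarrow> k \<in> S"
  shows "(\<exists>a m c. maximal_block True s a m \<and> odd (m - a) \<and>
      maximal_block False s m c \<and> odd (c - m)) \<longleftrightarrow>
    state_at S (length s) \<in> {Odd_Zeros, Bad}"
    (is "?L \<longleftrightarrow> _")
proof -
  define n where "n = length s"
  note block = maximal_block_iff_run[OF assms, folded n_def]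
  have "?L \<longleftrightarrow> (\<exists>c\<le>n. (c < n \<longrightarrow> c \<in> S) \<and> odd (run False S c) \<and>
      odd (run True S (c - run False S c)))" (is "_ \<longleftrightarrow> ?R")
  proof
    assume ?L
    then obtain a m c where "maximal_block True s a m" "odd (m - a)"
        "maximal_block False s m c" "odd (c - m)" by blast
    then have "m < c" "c \<le> n" "c < n \<longrightarrow> c \<in> S"
        "run True S m = m - a" "run False S c = c - m" "odd (m - a)" "odd (c - m)"
      by (simp_all add: block)
    then show ?R by (intro exI[of _ c]) simp
  next
    assume ?R
    then obtain c where c: "c \<le> n" "c < n \<longrightarrow> c \<in> S" "odd (run False S c)"
        "odd (run True S (c - run False S c))" by auto
    define m where "m = c - run False S c"
    define a where "a = m - run True S m"
    have "run True S m > 0" "run False S c > 0"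
      using c by (auto simp: m_def odd_pos)
    then have m: "a < m" "m < c" "run True S m = m - a" "run False S c = c - m"
      using run_le[of True S m] run_le[of False S c] by (auto simp: a_def m_def)
    \<comment> \<open>The 0 at \<open>m\<close> makes the block of 1s maximal on the right.\<close>
    have "m \<notin> S" using in_run[of c False S m] m by auto
    then have "maximal_block True s a m" "maximal_block False s m c"
      using m c by (auto simp: block)
    moreover have "odd (m - a)" "odd (c - m)"
      using c(3) c(4)[folded m_def] m(3,4) by simp_all
    ultimately show ?L by blast
  qed
  also have "\<dots> \<longleftrightarrow> (\<exists>c<n. c \<in> S \<and> odd (run False S c) \<and> odd (run True S (c - run False S c)))
      \<or> odd (run False S n) \<and> odd (run True S (n - run False S n))"
    by (auto simp: le_less)
  also have "\<dots> \<longleftrightarrow> state_at S n \<in> {Odd_Zeros, Bad}"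
  proof -
    have "run False S n = 0" if "run True S n > 0"
      using that by (cases n) (auto split: if_splits)
    then show ?thesis by (subst state_at_eq) auto
  qed
  finally show ?thesis by (simp add: n_def)
qed

lemma accepting_Suc:
  "accepting (state_at S (Suc k)) \<longleftrightarrow> k \<notin> S \<and> state_at S k \<notin> {Odd_Zeros, Bad}"
  by (cases "state_at S k") auto


section \<open>Order ideals of the shifted staircase as words\<close>

lemma finite_shifted_staircase: "finite (carrier (shifted_staircase n))"
proof (rule finite_subset)
  show "carrier (shifted_staircase n) \<subseteq> {..n} \<times> {..n}"
    by (auto simp: shifted_staircase_def)
qed simp

lemma partial_order_shifted_staircase: "partial_order (shifted_staircase n)"
  by unfold_locales (auto simp: shifted_staircase_def)

text \<open>Position \<open>k\<close> is 0-based and stands for digit \<open>k + 1\<close>, whence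
  the row length \<open>n - (k + 1) + 1 = n - k\<close>.\<close>

definition one_positions :: "nat \<Rightarrow> (nat \<times> nat) set \<Rightarrow> nat set" where
  "one_positions n v = {k. k < n \<and> (\<exists>i\<in>{1..n}. row_length v i = n - k)}"

lemma nth_binary_rep: "k < n \<Longrightarrow> binary_rep n v ! k \<longleftrightarrow> k \<in> one_positions n v"
  by (simp add: binary_rep_def one_positions_def Suc_diff_Suc del: upt_Suc)

locale staircase_ideal =
  fixes n :: nat and v :: "(nat \<times> nat) set"
  assumes order_ideal: "v \<in> order_ideals (shifted_staircase n)"
begin

lemma mem_bounds: "(i, j) \<in> v \<Longrightarrow> 1 \<le> i \<and> i \<le> j \<and> j \<le> n"
  using order_ideal by (auto simp: order_ideals_def shifted_staircase_def)

lemma mem_down: "(i, j) \<in> v \<Longrightarrow> 1 \<le> i' \<Longrightarrow> i' \<le> j' \<Longrightarrow> i' \<le> i \<Longrightarrow> j' \<le> j \<Longrightarrow> (i', j') \<in> v"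
proof -
  assume "(i, j) \<in> v" "1 \<le> i'" "i' \<le> j'" "i' \<le> i" "j' \<le> j"
  moreover have "j \<le> n" using \<open>(i, j) \<in> v\<close> mem_bounds by blast
  moreover have "\<forall>x\<in>v. \<forall>y\<in>carrier (shifted_staircase n). y \<sqsubseteq>\<^bsub>shifted_staircase n\<^esub> x \<longrightarrow> y \<in> v"
    using order_ideal by (simp add: order_ideals_def)
  ultimately show ?thesis
    by (auto simp: shifted_staircase_def)
qed

lemma finite_ideal: "finite v"
  using order_ideal finite_subset[OF _ finite_shifted_staircase[of n]]
  by (auto simp: order_ideals_def)

lemma row_eq:
  assumes "1 \<le> i"
  shows "{j. (i, j) \<in> v} = {i..<i + row_length v i}"
proof (cases "{j. (i, j) \<in> v} = {}")
  case True
  then show ?thesis by (simp add: row_length_def)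
next
  case False
  define M where "M = Max {j. (i, j) \<in> v}"
  have fin: "finite {j. (i, j) \<in> v}"
    by (rule finite_subset[of _ "{..n}"]) (use mem_bounds in auto)
  have "(i, M) \<in> v" and "\<And>j. (i, j) \<in> v \<Longrightarrow> j \<le> M"
    using Max_in[OF fin False] Max_ge[OF fin] by (auto simp: M_def)
  then have eq: "{j. (i, j) \<in> v} = {i..M}"
  proof (intro equalityI subsetI)
    fix j assume "j \<in> {i..M}"
    then show "j \<in> {j. (i, j) \<in> v}"
      using mem_down[of i M i j] \<open>(i, M) \<in> v\<close> assms by simp
  qed (use mem_bounds in auto)
  have "i \<le> M" using \<open>(i, M) \<in> v\<close> mem_bounds by auto
  then have "row_length v i = Suc M - i"
    unfolding row_length_def eq by simp
  then show ?thesis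
    unfolding eq using \<open>i \<le> M\<close> by auto
qed

lemma mem_iff: "(i, j) \<in> v \<longleftrightarrow> 1 \<le> i \<and> i \<le> j \<and> j < i + row_length v i"
proof (cases "1 \<le> i")
  case True
  then show ?thesis using row_eq[OF True] by (auto simp: set_eq_iff)
next
  case False
  then show ?thesis using mem_bounds by blast
qed

text \<open>Rows start on the diagonal. Row \<open>i\<close> contains the column in which the
  lower-closed row \<open>i'\<close> ends and starts \<open>i' - i\<close> columns earlier, so it is
  strictly longer.\<close>

lemma row_length_less:
  assumes "1 \<le> i" "i < i'" "row_length v i' > 0"
  shows "row_length v i' < row_length v i"
proof -
  have "(i', i' + row_length v i' - 1) \<in> v"
    using assms by (auto simp: mem_iff)
  then have "(i, i' + row_length v i' - 1) \<in> v"
    by (rule mem_down) (use assms in auto)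
  then show ?thesis using assms by (auto simp: mem_iff)
qed

lemma row_length_inj:
  assumes "1 \<le> i" "1 \<le> i'" "row_length v i = row_length v i'" "row_length v i > 0"
  shows "i = i'"
  using row_length_less[of i i'] row_length_less[of i' i] assms by (cases i i' rule: linorder_cases) auto

lemma row_length_bound:
  assumes "1 \<le> i" "row_length v i > 0"
  shows "i \<le> n \<and> row_length v i \<le> n"
proof -
  have "(i, i + row_length v i - 1) \<in> v"
    using assms by (auto simp: mem_iff)
  from mem_bounds[OF this] assms show ?thesis by auto
qed

lemma one_positions_eq:
  "one_positions n v = {k. k < n \<and> (\<exists>i\<ge>1. row_length v i = n - k)}"
proof -
  have "i \<le> n" if "k < n" "1 \<le> i" "row_length v i = n - k" for i k
    using row_length_bound[of i] that by simp
  then show ?thesis by (auto simp: one_positions_def)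
qed

text \<open>A cell is maximal iff its neighbours \<open>(i, Suc j)\<close> and
  \<open>(Suc i, j)\<close> are missing. In a row of length 1 the cell is diagonal and
  \<open>(Suc i, j)\<close> lies outside the staircase, hence the separate disjunct.\<close>

lemma maximal_elements_iff:
  "(i, j) \<in> maximal_elements (shifted_staircase n) v \<longleftrightarrow>
    1 \<le> i \<and> row_length v i > 0 \<and> Suc j = i + row_length v i \<and>
    (row_length v i = 1 \<or> Suc (row_length v (Suc i)) < row_length v i)"
    (is "?L \<longleftrightarrow> ?R")
proof
  assume L: ?L
  then have mem: "(i, j) \<in> v"
    and max: "\<And>i' j'. (i', j') \<in> v \<Longrightarrow> i \<le> i' \<Longrightarrow> j \<le> j' \<Longrightarrow> i' = i \<and> j' = j"
    by (auto simp: maximal_elements_def shifted_staircase_def)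
  have "(i, Suc j) \<notin> v" "(Suc i, j) \<notin> v" using max[of i "Suc j"] max[of "Suc i" j] by auto
  then show ?R using mem by (auto simp: mem_iff)
next
  assume R: ?R
  have mem: "(i, j) \<in> v" and right: "(i, Suc j) \<notin> v" and up: "(Suc i, j) \<notin> v"
    using R by (auto simp: mem_iff)
  have "(i', j') = (i, j)" if y: "(i', j') \<in> v" "i \<le> i'" "j \<le> j'" for i' j'
  proof -
    have "j' = j"
    proof (rule ccontr)
      assume "j' \<noteq> j"
      with y right R mem_down[OF y(1), of i "Suc j"] show False by auto
    qed
    moreover have "i' = i"
    proof (rule ccontr)
      assume "i' \<noteq> i"
      with y up \<open>j' = j\<close> mem_bounds[OF y(1)] mem_down[OF y(1), of "Suc i" j] show False by auto
    qed
    ultimately show ?thesis by simp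
  qed
  then show ?L
    using mem by (auto simp: maximal_elements_def shifted_staircase_def)
qed

section \<open>Removing maximal elements as moving 1s to the right\<close>

definition corner_position :: "nat \<times> nat \<Rightarrow> nat" where
  "corner_position x = n - row_length v (fst x)"

context
  fixes X :: "(nat \<times> nat) set"
  assumes X: "X \<subseteq> maximal_elements (shifted_staircase n) v"
begin

lemma row_length_diff:
  assumes "1 \<le> i"
  shows "row_length (v - X) i = (if i \<in> fst ` X then row_length v i - 1 else row_length v i)"
proof (cases "i \<in> fst ` X")
  case True
  \<comment> \<open>A row has at most one maximal cell, its last one, so \<open>X\<close> takes at
    most one cell from it.\<close>
  have uniq: "Suc j = i + row_length v i" if "(i, j) \<in> X" for j
    using that X maximal_elements_iff by blast
  obtain j where j: "(i, j) \<in> X" using True by auto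
  have "j' = j" if "(i, j') \<in> X" for j'
    using uniq[OF that] uniq[OF j] by simp
  then have "{j. (i, j) \<in> v - X} = {j. (i, j) \<in> v} - {j}"
    using j by blast
  moreover have "(i, j) \<in> v" using j X unfolding maximal_elements_def by blast
  ultimately show ?thesis
    using True by (simp add: row_length_def card_Diff_singleton)
next
  case False
  then have "{j. (i, j) \<in> v - X} = {j. (i, j) \<in> v}" by force
  with False show ?thesis by (simp add: row_length_def)
qed

lemma corner:
  assumes "i \<in> fst ` X"
  shows "1 \<le> i \<and> 0 < row_length v i \<and> row_length v i \<le> n \<and>
    (row_length v i = 1 \<or> Suc (row_length v (Suc i)) < row_length v i)"
proof -
  obtain j where "(i, j) \<in> X" using assms by auto
  then have "(i, j) \<in> maximal_elements (shifted_staircase n) v" using X by blast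
  then show ?thesis unfolding maximal_elements_iff using row_length_bound[of i] by auto
qed

lemma corner_positions_eq: "corner_position ` X = (\<lambda>i. n - row_length v i) ` fst ` X"
  unfolding image_image by (rule image_cong) (simp_all add: corner_position_def)

lemma word_move_corners: "word_move n (one_positions n v) (corner_position ` X)"
  unfolding word_move_def corner_positions_eq
proof
  fix k assume "k \<in> (\<lambda>i. n - row_length v i) ` fst ` X"
  then obtain i where i: "i \<in> fst ` X" and k: "k = n - row_length v i" by blast
  note c = corner[OF i]
  have "n - row_length v i \<in> one_positions n v"
    unfolding one_positions_eq using c by (auto intro!: exI[of _ i])
  moreover have "Suc (n - row_length v i) \<notin> one_positions n v"
    if "Suc (n - row_length v i) < n"
  proof
    assume "Suc (n - row_length v i) \<in> one_positions n v"
    then obtain i' where "1 \<le> i'" "row_length v i' = n - Suc (n - row_length v i)"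
      unfolding one_positions_eq by blast
    then have i': "1 \<le> i'" "row_length v i' = row_length v i - 1"
      using c by linarith+
    have pos: "row_length v i' > 0" using i'(2) that c by linarith
    have "\<not> i' < i"
      using row_length_less[of i' i] i' c by linarith
    moreover have "i' \<noteq> i" using i'(2) c by auto
    ultimately have "i < i'" by simp
    \<comment> \<open>A row one shorter than row \<open>i\<close> would come after it, so row
      \<open>Suc i\<close> would be at least that long, against the corner condition.\<close>
    then have "row_length v i' \<le> row_length v (Suc i)"
      using row_length_less[of "Suc i" i'] pos by (cases "i' = Suc i") simp_all
    then show False using c i'(2) pos by linarith
  qed
  ultimately show "k < n \<and> k \<in> one_positions n v \<and> (Suc k < n \<longrightarrow> Suc k \<notin> one_positions n v)"
    using c k by simp
qed

text \<open>Shortening a row by one shifts its 1 one place to the right. A row of length 1 vanishes,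
  and its 1 goes to position \<open>n\<close>, which the intersection cuts off.\<close>

lemma one_positions_diff:
  "one_positions n (v - X) = moved (one_positions n v) (corner_position ` X) \<inter> {..<n}"
proof -
  interpret diff: staircase_ideal n "v - X"
    by unfold_locales (rule diff_maximal_elements_in_order_ideals[OF order_ideal X])
  show ?thesis
  proof (intro equalityI subsetI)
    fix k assume "k \<in> one_positions n (v - X)"
    then obtain i where i: "k < n" "1 \<le> i" "row_length (v - X) i = n - k"
      unfolding diff.one_positions_eq by auto
    show "k \<in> moved (one_positions n v) (corner_position ` X) \<inter> {..<n}"
    proof (cases "i \<in> fst ` X")
      case True
      then have "k = Suc (n - row_length v i)"
        using i row_length_diff[OF i(2)] corner[OF True] True by simp linarith
      then show ?thesis
        using True i(1) unfolding moved_def corner_positions_eq by blast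
    next
      case False
      then have k: "row_length v i = n - k"
        using i row_length_diff[OF i(2)] False by simp
      \<comment> \<open>Nonempty rows have distinct lengths, so no row shortened by \<open>X\<close>
        shares the position of row \<open>i\<close>.\<close>
      have "k \<notin> corner_position ` X"
      proof
        assume "k \<in> corner_position ` X"
        then obtain i' where i': "i' \<in> fst ` X" "k = n - row_length v i'"
          unfolding corner_positions_eq by blast
        then have "row_length v i' = row_length v i"
          using corner[OF i'(1)] i(1) k by linarith
        then have "i' = i"
          using row_length_inj[of i' i] corner[OF i'(1)] i(2) by simp
        with i' False show False by simp
      qed
      moreover have "k \<in> one_positions n v"
        unfolding one_positions_eq using i(1,2) k by blast
      ultimately show ?thesis using i(1) by (simp add: moved_def)
    qed
  next
    fix k assume "k \<in> moved (one_positions n v) (corner_position ` X) \<inter> {..<n}"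
    then consider "k < n" "k \<in> one_positions n v" "k \<notin> corner_position ` X"
      | k' where "k < n" "k = Suc k'" "k' \<in> corner_position ` X"
      by (auto simp: moved_def)
    then show "k \<in> one_positions n (v - X)"
    proof cases
      case 1
      then obtain i where i: "1 \<le> i" "row_length v i = n - k"
        unfolding one_positions_eq by blast
      have "k = n - row_length v i" using i(2) 1(1) by linarith
      then have "i \<notin> fst ` X"
        using 1(3) unfolding corner_positions_eq by blast
      then have "row_length (v - X) i = n - k"
        using row_length_diff[OF i(1)] i(2) by simp
      then show ?thesis
        unfolding diff.one_positions_eq using i(1) 1(1) by blast
    next
      case 2
      then obtain i where i: "i \<in> fst ` X" "k' = n - row_length v i"
        unfolding corner_positions_eq by blast
      have "row_length (v - X) i = n - k"
        using row_length_diff[of i] corner[OF i(1)] i 2(2) by simp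
      then show ?thesis
        unfolding diff.one_positions_eq using corner[OF i(1)] 2(1) by blast
    qed
  qed
qed

lemma state_at_one_positions_diff:
  "state_at (one_positions n (v - X)) n =
    state_at (moved (one_positions n v) (corner_position ` X)) n"
  unfolding one_positions_diff by (rule state_at_cong) auto

end

lemma word_move_is_corner_removal:
  assumes "word_move n (one_positions n v) B"
  shows "\<exists>X. X \<subseteq> maximal_elements (shifted_staircase n) v \<and> B = corner_position ` X"
proof -
  define X where "X = {x \<in> maximal_elements (shifted_staircase n) v. corner_position x \<in> B}"
  have "B \<subseteq> corner_position ` X"
  proof
    fix k assume "k \<in> B"
    then have k: "k < n" "k \<in> one_positions n v" "Suc k < n \<Longrightarrow> Suc k \<notin> one_positions n v"
      using assms by (auto simp: word_move_def)
    then obtain i where i: "1 \<le> i" "row_length v i = n - k"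
      unfolding one_positions_eq by auto
    have "row_length v i = 1 \<or> Suc (row_length v (Suc i)) < row_length v i"
    proof (rule ccontr)
      \<comment> \<open>Then row \<open>Suc i\<close> is exactly one shorter and nonempty, and puts
        a 1 at \<open>Suc k\<close>.\<close>
      assume c: "\<not> ?thesis"
      then have "row_length v (Suc i) < row_length v i"
        using row_length_less[of i "Suc i"] i k by auto
      then have "row_length v (Suc i) = n - Suc k" "Suc k < n"
        using c i k by auto
      then show False
        using k(3) unfolding one_positions_eq by auto
    qed
    then have "(i, i + row_length v i - 1) \<in> maximal_elements (shifted_staircase n) v"
      using i k by (auto simp: maximal_elements_iff)
    moreover have "corner_position (i, i + row_length v i - 1) = k"
      using i k by (simp add: corner_position_def)
    ultimately show "k \<in> corner_position ` X"
      using \<open>k \<in> B\<close> unfolding X_def by force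
  qed
  then have "B = corner_position ` X" by (auto simp: X_def)
  then show ?thesis by (intro exI[of _ X]) (auto simp: X_def)
qed

end


section \<open>The characterisation\<close>

text \<open>The kernel consists of the ideals whose words are accepted, and the number of cells is
  the decreasing measure.\<close>

lemma eeta_win_iff_accepting:
  assumes "v \<in> order_ideals (shifted_staircase n)"
  shows "eeta_win (ideal_lattice (shifted_staircase n)) v \<longleftrightarrow>
    accepting (state_at (one_positions n v) n)"
proof (rule eeta_win_iff[where f = card and C = "order_ideals (shifted_staircase n)"])
  interpret partial_order "shifted_staircase n"
    by (rule partial_order_shifted_staircase)
  note move_iff = nontrivial_ungar_move_ideal_lattice[OF finite_shifted_staircase]
  fix v u assume v: "v \<in> order_ideals (shifted_staircase n)"
  interpret staircase_ideal n v by unfold_locales (rule v)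
  {
    assume "nontrivial_ungar_move (ideal_lattice (shifted_staircase n)) v u"
    then obtain X where X: "X \<subseteq> maximal_elements (shifted_staircase n) v" "X \<noteq> {}" "u = v - X"
      unfolding move_iff[OF v] by auto
    show "u \<in> order_ideals (shifted_staircase n)"
      using diff_maximal_elements_in_order_ideals[OF v X(1)] X(3) by simp
    have "u \<subset> v" using X by (auto simp: maximal_elements_def)
    then show "card u < card v" using finite_ideal by (rule psubset_card_mono[rotated])
    assume "accepting (state_at (one_positions n v) n)"
    then show "\<not> accepting (state_at (one_positions n u) n)"
      using leave_accepting[OF word_move_corners[OF X(1)]] X
      by (simp add: state_at_one_positions_diff[OF X(1)])
  }
  assume nacc: "\<not> accepting (state_at (one_positions n v) n)"
  then obtain B where B: "word_move n (one_positions n v) B"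
      "accepting (state_at (moved (one_positions n v) B) n)"
    using enter_accepting by blast
  obtain X where X: "X \<subseteq> maximal_elements (shifted_staircase n) v" "B = corner_position ` X"
    using word_move_is_corner_removal[OF B(1)] by auto
  \<comment> \<open>An empty \<open>X\<close> would leave the word unchanged, but the old word is
    rejected and the new one accepted.\<close>
  have "X \<noteq> {}" using nacc B X by (auto simp: moved_def)
  then show "\<exists>u. nontrivial_ungar_move (ideal_lattice (shifted_staircase n)) v u \<and>
      accepting (state_at (one_positions n u) n)"
    using B X unfolding move_iff[OF v] by (metis state_at_one_positions_diff)
qed (rule assms)

theorem theorem1p3:
  fixes n :: nat and v :: "(nat \<times> nat) set"
  assumes "n \<ge> 1"
    and "v \<in> order_ideals (shifted_staircase n)"
  shows "eeta_win (ideal_lattice (shifted_staircase n)) v \<longleftrightarrow>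
    \<not> binary_rep n v ! (n - 1) \<and>
    \<not> (\<exists>a m c.
          maximal_block True (take (n - 1) (binary_rep n v)) a m \<and> odd (m - a) \<and>
          maximal_block False (take (n - 1) (binary_rep n v)) m c \<and> odd (c - m))"
proof -
  have "length (take (n - 1) (binary_rep n v)) = n - 1"
    by (simp add: binary_rep_def)
  then have "(\<exists>a m c.
          maximal_block True (take (n - 1) (binary_rep n v)) a m \<and> odd (m - a) \<and>
          maximal_block False (take (n - 1) (binary_rep n v)) m c \<and> odd (c - m)) \<longleftrightarrow>
      state_at (one_positions n v) (n - 1) \<in> {Odd_Zeros, Bad}"
    using odd_blocks_iff_state_at[of "take (n - 1) (binary_rep n v)" "one_positions n v"]
    by (simp add: nth_binary_rep)
  then show ?thesis
    using eeta_win_iff_accepting[OF assms(2)] accepting_Suc[of "one_positions n v" "n - 1"]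
      nth_binary_rep[of "n - 1" n v] assms(1)
    by simp
qed

end
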